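(* Let $a,a_1,k$ be real constants with $a\neq0$. The rotationally symmetric map $\varphi:(S^2,dr^2+\sin^2r\,d\theta^2)\to(S^2,d\rho^2+\sin^2\rho\,d\phi^2)$ with $\varphi(r,\theta)=(ar+a_1,k\theta)$ is biharmonic if and only if $a^2=1$, $k^2=1$, and $a_1=0$ or $a_1=\pi$; that is, in the biharmonic case the map is actually harmonic.
   Context: All objects are smooth. $(r,\theta)$ and $(\rho,\phi)$ are geodesic polar coordinates on the domain and target unit 2-spheres, with $r\in(0,\pi)$ and $\rho\in(0,\pi)$. The map is given by its expression in these coordinates; it is considered on the open set of points with $r\in(0,\pi)$ and $\rho(r)=ar+a_1\in(0,\pi)$, which is assumed nonempty, and biharmonicity/harmonicity are understood there. The tension field of a map $\varphi:(M,g)\to(N,h)$ is $\tau(\varphi)=\mathrm{Tr}_g\nabla d\varphi$; $\varphi$ is harmonic if $\tau(\varphi)=0$, and biharmonic if $\tau_2(\varphi)=\mathrm{Tr}_g(\nabla^\varphi\nabla^\varphi-\nabla^\varphi_{\nabla^M})\tau(\varphi)-\mathrm{Tr}_gR^N(d\varphi,\tau(\varphi))d\varphi=0$, where $R^N(X,Y)Z=[\nabla^N_X,\nabla^N_Y]Z-\nabla^N_{[X,Y]}Z$. *)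

theory Defs
  imports "HOL-Analysis.Analysis"
begin

section \<open>Riemannian geometry in a coordinate chart\<close>

text \<open>
  A Riemannian metric on an open subset of \<open>\<real>\<^sup>n\<close> is given by its matrix-valued function
  \<open>g\<close>; vector fields are given by their components in the coordinate frame, and sections of a
  pull-back bundle \<open>\<phi>\<^sup>-\<^sup>1TN\<close> by their components in the coordinate frame of the target.
  All functions are total, but they are only meaningful on the chart under consideration.
\<close>

definition partial_deriv :: "'n::finite \<Rightarrow> (real^'n \<Rightarrow> 'b::real_normed_vector) \<Rightarrow> real^'n \<Rightarrow> 'b" where
  "partial_deriv i f x = frechet_derivative f (at x) (axis i 1)"

primrec Ck_on :: "nat \<Rightarrow> (real^'n::finite \<Rightarrow> 'b::real_normed_vector) \<Rightarrow> (real^'n) set \<Rightarrow> bool" where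
  "Ck_on 0 f U \<longleftrightarrow> continuous_on U f"
| "Ck_on (Suc m) f U \<longleftrightarrow>
     (\<forall>x\<in>U. f differentiable (at x)) \<and> (\<forall>i. Ck_on m (partial_deriv i f) U)"

definition smooth_on :: "(real^'n::finite \<Rightarrow> 'b::real_normed_vector) \<Rightarrow> (real^'n) set \<Rightarrow> bool" where
  "smooth_on f U \<longleftrightarrow> (\<forall>m. Ck_on m f U)"

definition coord_field :: "'n::finite \<Rightarrow> real^'n \<Rightarrow> real^'n" where
  "coord_field i x = axis i 1"

definition metric_trace ::
  "(real^'n \<Rightarrow> real^'n^'n) \<Rightarrow>
   ((real^'n \<Rightarrow> real^'n) \<Rightarrow> (real^'n \<Rightarrow> real^'n) \<Rightarrow> real^'n \<Rightarrow> real^'m) \<Rightarrow>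
   real^'n::finite \<Rightarrow> real^'m::finite" where
  "metric_trace g T x =
     (\<Sum>i\<in>UNIV. \<Sum>j\<in>UNIV. matrix_inv (g x) $ i $ j *\<^sub>R T (coord_field i) (coord_field j) x)"

definition christoffel ::
  "(real^'n::finite \<Rightarrow> real^'n^'n) \<Rightarrow> 'n \<Rightarrow> 'n \<Rightarrow> 'n \<Rightarrow> real^'n \<Rightarrow> real" where
  "christoffel g l i j x = 1 / 2 * (\<Sum>s\<in>UNIV. matrix_inv (g x) $ l $ s *
     (partial_deriv i (\<lambda>z. g z $ j $ s) x + partial_deriv j (\<lambda>z. g z $ i $ s) x
      - partial_deriv s (\<lambda>z. g z $ i $ j) x))"

definition christoffel_form ::
  "(real^'n::finite \<Rightarrow> real^'n^'n) \<Rightarrow> real^'n \<Rightarrow> real^'n \<Rightarrow> real^'n \<Rightarrow> real^'n" where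
  "christoffel_form g x u v =
     (\<chi> l. \<Sum>i\<in>UNIV. \<Sum>j\<in>UNIV. christoffel g l i j x * u $ i * v $ j)"

definition levi_civita ::
  "(real^'n::finite \<Rightarrow> real^'n^'n) \<Rightarrow> (real^'n \<Rightarrow> real^'n) \<Rightarrow> (real^'n \<Rightarrow> real^'n) \<Rightarrow> real^'n \<Rightarrow> real^'n" where
  "levi_civita g X Y x =
     frechet_derivative Y (at x) (X x) + christoffel_form g x (X x) (Y x)"

definition lie_bracket ::
  "(real^'n::finite \<Rightarrow> real^'n) \<Rightarrow> (real^'n \<Rightarrow> real^'n) \<Rightarrow> real^'n \<Rightarrow> real^'n" where
  "lie_bracket X Y x = frechet_derivative Y (at x) (X x) - frechet_derivative X (at x) (Y x)"

definition curvature ::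
  "(real^'n::finite \<Rightarrow> real^'n^'n) \<Rightarrow> (real^'n \<Rightarrow> real^'n) \<Rightarrow> (real^'n \<Rightarrow> real^'n) \<Rightarrow>
   (real^'n \<Rightarrow> real^'n) \<Rightarrow> real^'n \<Rightarrow> real^'n" where
  "curvature g X Y Z x =
     levi_civita g X (levi_civita g Y Z) x - levi_civita g Y (levi_civita g X Z) x
     - levi_civita g (lie_bracket X Y) Z x"

text \<open>
  The curvature is tensorial, so its value on tangent vectors at a point can be computed from any
  extensions to vector fields; we take those with constant coefficients.
\<close>

definition curvature_at ::
  "(real^'n::finite \<Rightarrow> real^'n^'n) \<Rightarrow> real^'n \<Rightarrow> real^'n \<Rightarrow> real^'n \<Rightarrow> real^'n \<Rightarrow> real^'n" where
  "curvature_at g y u v w = curvature g (\<lambda>_. u) (\<lambda>_. v) (\<lambda>_. w) y"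

section \<open>Harmonic and biharmonic maps\<close>

definition push_field ::
  "(real^'n::finite \<Rightarrow> real^'m::finite) \<Rightarrow> (real^'n \<Rightarrow> real^'n) \<Rightarrow> real^'n \<Rightarrow> real^'m" where
  "push_field \<phi> X x = frechet_derivative \<phi> (at x) (X x)"

text \<open>The pull-back \<open>\<nabla>\<^sup>\<phi>\<close> of the Levi-Civita connection of the target metric \<open>h\<close>.\<close>

definition pullback_connection ::
  "(real^'m::finite \<Rightarrow> real^'m^'m) \<Rightarrow> (real^'n::finite \<Rightarrow> real^'m) \<Rightarrow>
   (real^'n \<Rightarrow> real^'n) \<Rightarrow> (real^'n \<Rightarrow> real^'m) \<Rightarrow> real^'n \<Rightarrow> real^'m" where
  "pullback_connection h \<phi> X V x =
     frechet_derivative V (at x) (X x) + christoffel_form h (\<phi> x) (push_field \<phi> X x) (V x)"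

text \<open>\<open>(\<nabla>d\<phi>)(X, Y) = \<nabla>\<^sup>\<phi>\<^sub>X (d\<phi> Y) - d\<phi> (\<nabla>\<^sub>X Y)\<close>\<close>

definition second_fundamental_form ::
  "(real^'n::finite \<Rightarrow> real^'n^'n) \<Rightarrow> (real^'m::finite \<Rightarrow> real^'m^'m) \<Rightarrow> (real^'n \<Rightarrow> real^'m) \<Rightarrow>
   (real^'n \<Rightarrow> real^'n) \<Rightarrow> (real^'n \<Rightarrow> real^'n) \<Rightarrow> real^'n \<Rightarrow> real^'m" where
  "second_fundamental_form g h \<phi> X Y x =
     pullback_connection h \<phi> X (push_field \<phi> Y) x - push_field \<phi> (levi_civita g X Y) x"

definition tension_field ::
  "(real^'n::finite \<Rightarrow> real^'n^'n) \<Rightarrow> (real^'m::finite \<Rightarrow> real^'m^'m) \<Rightarrow> (real^'n \<Rightarrow> real^'m) \<Rightarrow>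
   real^'n \<Rightarrow> real^'m" where
  "tension_field g h \<phi> = metric_trace g (second_fundamental_form g h \<phi>)"

definition bitension_field ::
  "(real^'n::finite \<Rightarrow> real^'n^'n) \<Rightarrow> (real^'m::finite \<Rightarrow> real^'m^'m) \<Rightarrow> (real^'n \<Rightarrow> real^'m) \<Rightarrow>
   real^'n \<Rightarrow> real^'m" where
  "bitension_field g h \<phi> x =
     metric_trace g (\<lambda>X Y z.
       pullback_connection h \<phi> X (pullback_connection h \<phi> Y (tension_field g h \<phi>)) z
       - pullback_connection h \<phi> (levi_civita g X Y) (tension_field g h \<phi>) z) x
     - metric_trace g (\<lambda>X Y z.
         curvature_at h (\<phi> z) (push_field \<phi> X z) (tension_field g h \<phi> z) (push_field \<phi> Y z)) x"

text \<open>In the following two definitions, \<open>U\<close> is meant to be open.\<close>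

definition harmonic_on ::
  "(real^'n::finite \<Rightarrow> real^'n^'n) \<Rightarrow> (real^'m::finite \<Rightarrow> real^'m^'m) \<Rightarrow> (real^'n \<Rightarrow> real^'m) \<Rightarrow>
   (real^'n) set \<Rightarrow> bool" where
  "harmonic_on g h \<phi> U \<longleftrightarrow> smooth_on \<phi> U \<and> (\<forall>x\<in>U. tension_field g h \<phi> x = 0)"

definition biharmonic_on ::
  "(real^'n::finite \<Rightarrow> real^'n^'n) \<Rightarrow> (real^'m::finite \<Rightarrow> real^'m^'m) \<Rightarrow> (real^'n \<Rightarrow> real^'m) \<Rightarrow>
   (real^'n) set \<Rightarrow> bool" where
  "biharmonic_on g h \<phi> U \<longleftrightarrow> smooth_on \<phi> U \<and> (\<forall>x\<in>U. bitension_field g h \<phi> x = 0)"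

section \<open>Rotationally symmetric maps between 2-spheres\<close>

text \<open>
  Geodesic polar coordinates \<open>(r, \<theta>)\<close> of the unit 2-sphere are \<open>(x $ 1, x $ 2)\<close>. The angle
  ranges over the universal cover \<open>\<real>\<close> of the circle, so that the angular component \<open>k * \<theta>\<close> makes
  sense for every real \<open>k\<close>; harmonicity and biharmonicity are local conditions.
\<close>

definition polar_chart :: "(real^2) set" where
  "polar_chart = {x. 0 < x $ 1 \<and> x $ 1 < pi}"

definition sphere_metric :: "real^2 \<Rightarrow> real^2^2" where
  "sphere_metric x = vector [vector [1, 0], vector [0, (sin (x $ 1))\<^sup>2]]"

definition rot_map :: "real \<Rightarrow> real \<Rightarrow> real \<Rightarrow> real^2 \<Rightarrow> real^2" where
  "rot_map a a1 k x = vector [a * x $ 1 + a1, k * x $ 2]"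

definition rot_domain :: "real \<Rightarrow> real \<Rightarrow> real \<Rightarrow> (real^2) set" where
  "rot_domain a a1 k = {x \<in> polar_chart. rot_map a a1 k x \<in> polar_chart}"

end

theory Submission
  imports Defs
begin

text \<open>
  Write \<open>\<rho>(r) = a r + a\<^sub>1\<close>. By rotational symmetry the tension field is radial,
  \<open>\<tau> = F(r) \<partial>\<^sub>\<rho>\<close> with \<open>F = a cot r - k\<^sup>2 sin \<rho> cos \<rho> / sin\<^sup>2 r\<close>, and since the target has
  constant curvature \<open>1\<close> the bitension field is again radial, with coefficient
  \<open>F'' + cot r F' - k\<^sup>2 cos (2 \<rho>) / sin\<^sup>2 r F\<close> (\<open>tension_field_rot_map\<close> and
  \<open>bitension_field_rot_map\<close>).

  Multiplied by \<open>sin\<^sup>4 r\<close>, this coefficient becomes a trigonometric polynomial in \<open>t = 2 r\<close> with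
  the five frequencies \<open>1\<close>, \<open>a\<close>, \<open>a + 1\<close>, \<open>a - 1\<close>, \<open>2 a\<close> (\<open>bitension_trig_polynomial\<close>). It
  vanishes on an interval only if, for every value of \<open>\<omega>\<^sup>2\<close>, the terms of frequency \<open>\<plusminus>\<omega>\<close> cancel
  among themselves (\<open>sinusoid_frequency_separation\<close>). If \<open>k = 0\<close> the term of frequency \<open>1\<close>,
  whose coefficient is \<open>a / 2\<close>, remains. If \<open>k \<noteq> 0\<close> and \<open>a\<^sup>2 \<noteq> 1\<close>, the frequency
  \<open>\<bar>a\<bar> + 1\<close> occurs exactly once, and its coefficient is a nonzero multiple of
  \<open>a\<^sup>2 - \<bar>a\<bar> + 1/2 > 0\<close>. So \<open>a\<^sup>2 = 1\<close>; then the constant term gives \<open>sin (2 a\<^sub>1) = 0\<close>, and the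
  terms of frequency \<open>2\<close> give \<open>k\<^sup>2 = cos (2 a\<^sub>1)\<close>, hence \<open>k\<^sup>2 = 1\<close> and \<open>a\<^sub>1 \<in> \<pi>\<int>\<close>. That the
  domain is nonempty leaves only \<open>a\<^sub>1 = 0\<close> and \<open>a\<^sub>1 = \<pi>\<close>.

  Conversely, for these parameters \<open>\<rho> = r\<close> or \<open>\<rho> = \<pi> - r\<close>, so that \<open>F = 0\<close>: the map is
  harmonic and therefore biharmonic.
\<close>

section \<open>The geometry of the round sphere in polar coordinates\<close>

lemma has_vector_derivative_vector_2:
  assumes "(P has_real_derivative P') (at r)" "(Q has_real_derivative Q') (at r)"
  shows "((\<lambda>r. vector [P r, Q r] :: real^2) has_vector_derivative vector [P', Q']) (at r)"
proof -
  have e: "(vector [p, q] :: real^2) = p *\<^sub>R axis 1 1 + q *\<^sub>R axis 2 1" for p q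
    by (auto simp: vec_eq_iff forall_2 axis_def)
  show ?thesis
    unfolding e
    using assms by (auto intro!: derivative_eq_intros
        simp: has_real_derivative_iff_has_vector_derivative)
qed

text \<open>
  Apart from the map itself, everything differentiated below is a function of the radial coordinate
  alone, with a known formula on an open set only. This lemma reduces those Frechet derivatives to
  derivatives in one real variable.
\<close>

lemma frechet_derivative_first_coord:
  fixes V :: "real^2 \<Rightarrow> 'b::real_normed_vector"
  assumes "open S" "x \<in> S" and V: "\<And>z. z \<in> S \<Longrightarrow> V z = P (z $ 1)"
    and P: "(P has_vector_derivative P') (at (x $ 1))"
  shows "frechet_derivative V (at x) = (\<lambda>h. h $ 1 *\<^sub>R P')"
proof -
  have 1: "((\<lambda>z::real^2. z $ 1) has_derivative (\<lambda>h. h $ 1)) (at x)"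
    by (intro bounded_linear_imp_has_derivative bounded_linear_vec_nth)
  have "(P \<circ> (\<lambda>z. z $ 1) has_derivative (\<lambda>h. h *\<^sub>R P') \<circ> (\<lambda>h. h $ 1)) (at x)"
    by (rule diff_chain_at[OF 1]) (use P in \<open>simp add: has_vector_derivative_def\<close>)
  then have "((\<lambda>z. P (z $ 1)) has_derivative (\<lambda>h. h $ 1 *\<^sub>R P')) (at x)"
    by (simp add: o_def)
  then have "(V has_derivative (\<lambda>h. h $ 1 *\<^sub>R P')) (at x)"
    by (rule has_derivative_transform_within_open[OF _ assms(1,2)]) (simp add: V)
  then show ?thesis
    by (rule frechet_derivative_at[symmetric])
qed

lemma sphere_metric_nth:
  "sphere_metric x $ 1 $ 1 = 1" "sphere_metric x $ 1 $ 2 = 0"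
  "sphere_metric x $ 2 $ 1 = 0" "sphere_metric x $ 2 $ 2 = (sin (x $ 1))\<^sup>2"
  by (simp_all add: sphere_metric_def)

lemma matrix_inv_sphere_metric:
  assumes "sin (x $ 1) \<noteq> 0"
  shows "matrix_inv (sphere_metric x) = vector [vector [1, 0], vector [0, 1 / (sin (x $ 1))\<^sup>2]]"
proof -
  let ?B = "vector [vector [1, 0], vector [0, 1 / (sin (x $ 1))\<^sup>2]] :: real^2^2"
  have B: "sphere_metric x ** ?B = mat 1" "?B ** sphere_metric x = mat 1"
    using assms
    by (auto simp: vec_eq_iff forall_2 matrix_matrix_mult_def sum_2 mat_def sphere_metric_nth)
  then have inv: "matrix_inv (sphere_metric x) ** sphere_metric x = mat 1"
    unfolding matrix_inv_def
    using someI[of "\<lambda>B. sphere_metric x ** B = mat 1 \<and> B ** sphere_metric x = mat 1" ?B]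
    by blast
  have "matrix_inv (sphere_metric x) = (matrix_inv (sphere_metric x) ** sphere_metric x) ** ?B"
    by (simp add: matrix_mul_assoc[symmetric] B(1))
  also have "\<dots> = ?B"
    by (simp add: inv)
  finally show ?thesis .
qed

lemma metric_trace_sphere:
  assumes "sin (x $ 1) \<noteq> 0"
  shows "metric_trace sphere_metric T x
           = T (coord_field 1) (coord_field 1) x
             + (1 / (sin (x $ 1))\<^sup>2) *\<^sub>R T (coord_field 2) (coord_field 2) x"
  by (simp add: metric_trace_def matrix_inv_sphere_metric[OF assms] sum_2)

lemma partial_deriv_sphere_metric:
  "partial_deriv i (\<lambda>z. sphere_metric z $ j $ s) x
     = (if i = 1 \<and> j = 2 \<and> s = 2 then 2 * sin (x $ 1) * cos (x $ 1) else 0)"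
proof -
  define G :: "real \<Rightarrow> real" where
    "G r = (if j = 2 \<and> s = 2 then (sin r)\<^sup>2 else if j = s then 1 else 0)" for r
  have G: "sphere_metric z $ j $ s = G (z $ 1)" for z
    using exhaust_2[of j] exhaust_2[of s] by (auto simp: G_def sphere_metric_nth)
  have "(G has_real_derivative (if j = 2 \<and> s = 2 then 2 * sin (x $ 1) * cos (x $ 1) else 0)) (at (x $ 1))"
    unfolding G_def by (auto intro!: derivative_eq_intros)
  then have "frechet_derivative (\<lambda>z. sphere_metric z $ j $ s) (at x)
      = (\<lambda>h. h $ 1 *\<^sub>R (if j = 2 \<and> s = 2 then 2 * sin (x $ 1) * cos (x $ 1) else 0))"
    by (intro frechet_derivative_first_coord[of UNIV])
       (simp_all add: G has_real_derivative_iff_has_vector_derivative)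
  then show ?thesis
    using exhaust_2[of i] by (auto simp: partial_deriv_def axis_def)
qed

lemma christoffel_form_sphere:
  assumes "sin (y $ 1) \<noteq> 0"
  shows "christoffel_form sphere_metric y u v
     = vector [- sin (y $ 1) * cos (y $ 1) * u $ 2 * v $ 2,
               cot (y $ 1) * (u $ 1 * v $ 2 + u $ 2 * v $ 1)]"
  using assms
  by (simp add: christoffel_form_def vec_eq_iff forall_2 sum_2 christoffel_def
      partial_deriv_sphere_metric matrix_inv_sphere_metric cot_def)
    (simp add: field_simps power2_eq_square)

lemma open_sin_nonzero: "open {y::real^2. sin (y $ 1) \<noteq> 0}"
  by (intro open_Collect_neq continuous_intros)

lemma levi_civita_const:
  "levi_civita g (\<lambda>_. u) (\<lambda>_. v) x = christoffel_form g x u v"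
  by (simp add: levi_civita_def frechet_derivative_const)

lemma christoffel_form_0: "christoffel_form g y 0 v = 0"
  by (simp add: christoffel_form_def vec_eq_iff)

lemma cot_has_derivative:
  assumes "sin r \<noteq> (0::real)"
  shows "(cot has_real_derivative - 1 / (sin r)\<^sup>2) (at r)"
  using DERIV_cot[OF assms] by (simp add: inverse_eq_divide)

text \<open>
  The second covariant derivatives that enter the curvature. The first summand is the derivative
  of the Christoffel symbols in the direction \<open>u\<close>.
\<close>

lemma levi_civita_christoffel_sphere:
  assumes "sin (y $ 1) \<noteq> 0"
  shows "levi_civita sphere_metric (\<lambda>_. u) (levi_civita sphere_metric (\<lambda>_. v) (\<lambda>_. w)) y
    = vector [((sin (y $ 1))\<^sup>2 - (cos (y $ 1))\<^sup>2) * v $ 2 * w $ 2 * u $ 1,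
              - (1 / (sin (y $ 1))\<^sup>2) * (v $ 1 * w $ 2 + v $ 2 * w $ 1) * u $ 1]
      + christoffel_form sphere_metric y u (christoffel_form sphere_metric y v w)"
proof -
  have "frechet_derivative (levi_civita sphere_metric (\<lambda>_. v) (\<lambda>_. w)) (at y)
     = (\<lambda>h. h $ 1 *\<^sub>R vector [((sin (y $ 1))\<^sup>2 - (cos (y $ 1))\<^sup>2) * v $ 2 * w $ 2,
              - (1 / (sin (y $ 1))\<^sup>2) * (v $ 1 * w $ 2 + v $ 2 * w $ 1)])"
  proof (rule frechet_derivative_first_coord[OF open_sin_nonzero])
    show "((\<lambda>r. vector [- sin r * cos r * v $ 2 * w $ 2, cot r * (v $ 1 * w $ 2 + v $ 2 * w $ 1)] :: real^2)
       has_vector_derivative vector [((sin (y $ 1))\<^sup>2 - (cos (y $ 1))\<^sup>2) * v $ 2 * w $ 2,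
              - (1 / (sin (y $ 1))\<^sup>2) * (v $ 1 * w $ 2 + v $ 2 * w $ 1)]) (at (y $ 1))"
      by (rule has_vector_derivative_vector_2)
         (use assms in \<open>auto intro!: derivative_eq_intros cot_has_derivative
            simp: algebra_simps power2_eq_square divide_inverse\<close>)
  qed (use assms in \<open>auto simp: levi_civita_const christoffel_form_sphere\<close>)
  then show ?thesis
    by (simp add: levi_civita_def[of _ "\<lambda>_. u"] levi_civita_const vec_eq_iff forall_2 algebra_simps)
qed

text \<open>
  The unit sphere has constant curvature \<open>1\<close>: \<open>R(u, v) w = \<langle>v, w\<rangle> u - \<langle>u, w\<rangle> v\<close>.
\<close>

lemma sphere_curvature:
  assumes "sin (y $ 1) \<noteq> 0"
  shows "curvature_at sphere_metric y u v w
    = (v $ 1 * w $ 1 + (sin (y $ 1))\<^sup>2 * v $ 2 * w $ 2) *\<^sub>R u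
      - (u $ 1 * w $ 1 + (sin (y $ 1))\<^sup>2 * u $ 2 * w $ 2) *\<^sub>R v"
proof -
  have "lie_bracket (\<lambda>_. u) (\<lambda>_. v) = (\<lambda>_. 0 :: real^2)"
    by (simp add: fun_eq_iff lie_bracket_def frechet_derivative_const)
  \<comment> \<open>With \<open>cos\<close> and \<open>1 / sin\<^sup>2\<close> written in terms of \<open>cot\<close>, the claim
    is a polynomial identity in \<open>sin\<close> and \<open>cot\<close>.\<close>
  moreover have "cos (y $ 1) = cot (y $ 1) * sin (y $ 1)"
    using assms by (simp add: cot_def)
  moreover have "1 / (sin (y $ 1))\<^sup>2 = 1 + (cot (y $ 1))\<^sup>2"
    using assms by (simp add: cot_def cos_squared_eq field_simps)
  ultimately show ?thesis
    unfolding curvature_at_def curvature_def levi_civita_christoffel_sphere[OF assms]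
      christoffel_form_sphere[OF assms] levi_civita_const
    by (simp add: levi_civita_const christoffel_form_0 vec_eq_iff forall_2 algebra_simps power2_eq_square)
qed

section \<open>Separating the frequencies of a trigonometric sum\<close>

text \<open>
  Differentiating twice multiplies the \<open>j\<close>-th sinusoid by \<open>- w\<^sub>j\<^sup>2\<close>, and the zero function stays zero.
\<close>

lemma sinusoid_powers:
  fixes c w b :: "'i \<Rightarrow> real"
  assumes "open S" and 0: "\<And>x. x \<in> S \<Longrightarrow> (\<Sum>j\<in>J. c j * sin (w j * x + b j)) = 0" and "x \<in> S"
  shows "(\<Sum>j\<in>J. c j * ((w j)\<^sup>2) ^ n * sin (w j * x + b j)) = 0"
  using \<open>x \<in> S\<close>
proof (induction n arbitrary: x)
  case 0
  then show ?case using assms(2) by simp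
next
  case (Suc n)
  let ?d = "\<lambda>j. c j * ((w j)\<^sup>2) ^ n"
  have D1: "(\<Sum>j\<in>J. ?d j * w j * cos (w j * x + b j)) = 0" if "x \<in> S" for x
  proof (rule DERIV_unique)
    show "((\<lambda>x. \<Sum>j\<in>J. ?d j * sin (w j * x + b j)) has_real_derivative
      (\<Sum>j\<in>J. ?d j * w j * cos (w j * x + b j))) (at x)"
      by (auto intro!: derivative_eq_intros sum.cong simp: algebra_simps)
    show "((\<lambda>x. \<Sum>j\<in>J. ?d j * sin (w j * x + b j)) has_real_derivative 0) (at x)"
      by (rule has_field_derivative_transform_within_open[OF DERIV_const[of 0] \<open>open S\<close> that])
         (simp add: Suc.IH)
  qed
  have "(\<Sum>j\<in>J. - (?d j * w j * w j * sin (w j * x + b j))) = 0"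
  proof (rule DERIV_unique)
    show "((\<lambda>x. \<Sum>j\<in>J. ?d j * w j * cos (w j * x + b j)) has_real_derivative
      (\<Sum>j\<in>J. - (?d j * w j * w j * sin (w j * x + b j)))) (at x)"
      by (auto intro!: derivative_eq_intros sum.cong simp: algebra_simps)
    show "((\<lambda>x. \<Sum>j\<in>J. ?d j * w j * cos (w j * x + b j)) has_real_derivative 0) (at x)"
      by (rule has_field_derivative_transform_within_open[OF DERIV_const[of 0] \<open>open S\<close> \<open>x \<in> S\<close>])
         (simp add: D1)
  qed
  then show ?case
    by (simp add: sum_negf power2_eq_square mult_ac)
qed

text \<open>
  Linear combinations of iterated second derivatives multiply the \<open>j\<close>-th sinusoid by
  \<open>p(w\<^sub>j\<^sup>2)\<close> for any real polynomial \<open>p\<close>. A polynomial that vanishes at every squared frequency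
  except \<open>m\<close> isolates the terms with \<open>w\<^sub>j\<^sup>2 = m\<close>.
\<close>

lemma sinusoid_frequency_separation:
  fixes c w b :: "'i \<Rightarrow> real"
  assumes "finite J" "open S"
    and 0: "\<And>x. x \<in> S \<Longrightarrow> (\<Sum>j\<in>J. c j * sin (w j * x + b j)) = 0" and "x \<in> S"
  shows "(\<Sum>j | j \<in> J \<and> (w j)\<^sup>2 = m. c j * sin (w j * x + b j)) = 0"
proof -
  have poly: "(\<Sum>j\<in>J. c j * poly p ((w j)\<^sup>2) * sin (w j * x + b j)) = 0" for p
  proof -
    have "(\<Sum>j\<in>J. c j * poly p ((w j)\<^sup>2) * sin (w j * x + b j))
      = (\<Sum>j\<in>J. \<Sum>n\<le>degree p. coeff p n * (c j * ((w j)\<^sup>2) ^ n * sin (w j * x + b j)))"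
      by (simp add: poly_altdef sum_distrib_left sum_distrib_right mult_ac)
    also have "\<dots> = (\<Sum>n\<le>degree p. coeff p n * (\<Sum>j\<in>J. c j * ((w j)\<^sup>2) ^ n * sin (w j * x + b j)))"
      by (subst sum.swap) (simp add: sum_distrib_left)
    also have "\<dots> = 0"
      by (simp add: sinusoid_powers[OF assms(2-4)])
    finally show ?thesis .
  qed
  define p where "p = (\<Prod>v\<in>(\<lambda>j. (w j)\<^sup>2) ` J - {m}. [:- v, 1:])"
  have p: "poly p v = 0 \<longleftrightarrow> v \<in> (\<lambda>j. (w j)\<^sup>2) ` J - {m}" for v
    using \<open>finite J\<close> by (auto simp: p_def poly_prod)
  have "0 = (\<Sum>j\<in>J. c j * poly p ((w j)\<^sup>2) * sin (w j * x + b j))"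
    by (simp add: poly)
  also have "\<dots> = (\<Sum>j | j \<in> J \<and> (w j)\<^sup>2 = m. c j * poly p ((w j)\<^sup>2) * sin (w j * x + b j))"
    by (rule sum.mono_neutral_right) (use \<open>finite J\<close> p in auto)
  also have "\<dots> = (\<Sum>j | j \<in> J \<and> (w j)\<^sup>2 = m. poly p m * (c j * sin (w j * x + b j)))"
    by (rule sum.cong) auto
  also have "\<dots> = poly p m * (\<Sum>j | j \<in> J \<and> (w j)\<^sup>2 = m. c j * sin (w j * x + b j))"
    by (simp add: sum_distrib_left)
  finally show ?thesis using p[of m] by auto
qed

lemma sinusoid_eq_0:
  fixes c w b :: real
  assumes "open S" "S \<noteq> {}" "w \<noteq> 0" and 0: "\<And>x. x \<in> S \<Longrightarrow> c * sin (w * x + b) = 0"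
  shows "c = 0"
proof -
  obtain x where x: "x \<in> S" using assms by blast
  have "c * w * cos (w * x + b) = 0"
  proof (rule DERIV_unique)
    show "((\<lambda>x. c * sin (w * x + b)) has_real_derivative c * w * cos (w * x + b)) (at x)"
      by (auto intro!: derivative_eq_intros)
    show "((\<lambda>x. c * sin (w * x + b)) has_real_derivative 0) (at x)"
      by (rule has_field_derivative_transform_within_open[OF DERIV_const[of 0] \<open>open S\<close> x])
         (simp add: 0)
  qed
  moreover have "sin (w * x + b) \<noteq> 0 \<or> cos (w * x + b) \<noteq> 0"
    using sin_cos_squared_add[of "w * x + b"] by fastforce
  ultimately show "c = 0" using 0[OF x] \<open>w \<noteq> 0\<close> by auto
qed

text \<open>
  The analytic core: here \<open>K = k\<^sup>2\<close> and \<open>b = 2 a\<^sub>1\<close>. The two coefficients \<open>a\<^sup>2 - a + 1/2\<close> and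
  \<open>a\<^sup>2 + a + 1/2\<close> are always positive, which is what makes the frequency \<open>\<bar>a\<bar> + 1\<close> decisive.
\<close>

lemma trig_identity_solutions:
  fixes a K b :: real
  assumes "open S" "S \<noteq> {}" "a \<noteq> 0" "K \<ge> 0"
    and E: "\<And>x. x \<in> S \<Longrightarrow> a / 2 * sin x + K * (a\<^sup>2 - 3/2) * sin (a * x + b)
       - K / 2 * (a\<^sup>2 - a + 1/2) * sin ((a + 1) * x + b)
       - K / 2 * (a\<^sup>2 + a + 1/2) * sin ((a - 1) * x + b)
       + K\<^sup>2 / 4 * sin (2 * a * x + 2 * b) = 0"
  shows "a\<^sup>2 = 1" "K = 1" "cos b = 1"
proof -
  have pos: "a\<^sup>2 - a + 1/2 > 0" "a\<^sup>2 + a + 1/2 > 0"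
    using zero_le_power2[of "a - 1/2"] zero_le_power2[of "a + 1/2"]
    by (auto simp: power2_eq_square algebra_simps)
  define c where "c = (\<lambda>j::nat. [a/2, K * (a\<^sup>2 - 3/2), - (K / 2 * (a\<^sup>2 - a + 1/2)),
     - (K / 2 * (a\<^sup>2 + a + 1/2)), K\<^sup>2 / 4] ! j)"
  define w where "w = (\<lambda>j::nat. [1, a, a + 1, a - 1, 2 * a] ! j)"
  define d where "d = (\<lambda>j::nat. [0, b, b, b, 2 * b] ! j)"
  have w: "w 0 = 1" "w (Suc 0) = a" "w 2 = a + 1" "w 3 = a - 1" "w 4 = 2 * a"
    by (simp_all add: w_def)
  have c: "c 2 = - (K / 2 * (a\<^sup>2 - a + 1/2))" "c 3 = - (K / 2 * (a\<^sup>2 + a + 1/2))" "c 4 = K\<^sup>2 / 4"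
    by (simp_all add: c_def)
  have d: "d 2 = b" "d 3 = b" "d 4 = 2 * b"
    by (simp_all add: d_def)
  have sep: "(\<Sum>j | j < 5 \<and> (w j)\<^sup>2 = m. c j * sin (w j * x + d j)) = 0" if "x \<in> S" for x m
    using sinusoid_frequency_separation[of "{..<5}" S c w d x m] that \<open>open S\<close> E
    by (auto simp: c_def w_def d_def numeral_eq_Suc)
  have K0: "K \<noteq> 0"
  proof
    assume "K = 0"
    then have "a / 2 = 0"
      using sinusoid_eq_0[OF assms(1,2), of 1 "a/2" 0] E by simp
    then show False using \<open>a \<noteq> 0\<close> by simp
  qed
  have lt5: "j < 5 \<longleftrightarrow> j \<in> {0,1,2,3,4}" for j :: nat by auto
  show a1: "a\<^sup>2 = 1"
  proof (rule ccontr)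
    assume ne: "a\<^sup>2 \<noteq> 1"
    then have ne': "a \<noteq> 1" "a \<noteq> -1" by auto
    \<comment> \<open>The index of the frequency \<open>\<plusminus>(\<bar>a\<bar> + 1)\<close>, which no other term has.\<close>
    define i :: nat where "i = (if a > 0 then 2 else 3)"
    have "{j. j < 5 \<and> (w j)\<^sup>2 = (w i)\<^sup>2} = {i}"
      using ne' \<open>a \<noteq> 0\<close>
      by (auto simp: lt5 i_def w power2_eq_iff split: if_splits)
    then have "c i * sin (w i * x + d i) = 0" if "x \<in> S" for x
      using sep[OF that, of "(w i)\<^sup>2"] by simp
    moreover have "w i \<noteq> 0" using ne' by (auto simp: i_def w)
    ultimately have "c i = 0" using sinusoid_eq_0[OF assms(1,2)] by blast
    then show False using pos K0 by (auto simp: i_def c split: if_splits)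
  qed
  then have a: "a = 1 \<or> a = -1" by (simp add: power2_eq_1_iff)
  obtain x0 where x0: "x0 \<in> S" using assms by blast
  \<comment> \<open>Of the frequencies \<open>a + 1\<close> and \<open>a - 1\<close>, one is now \<open>0\<close> (index \<open>i\<close>) and the other is
    \<open>2 a\<close> (index \<open>i'\<close>), where it meets the last term.\<close>
  define i :: nat where "i = (if a = 1 then 3 else 2)"
  define i' :: nat where "i' = (if a = 1 then 2 else 3)"
  have "{j. j < 5 \<and> (w j)\<^sup>2 = 0} = {i}"
    using a by (auto simp: lt5 i_def w split: if_splits)
  then have "c i * sin b = 0"
    using sep[OF x0, of 0] a by (auto simp: i_def w d split: if_splits)
  then have sb: "sin b = 0"
    using K0 pos by (auto simp: i_def c split: if_splits)
  have "{j. j < 5 \<and> (w j)\<^sup>2 = 4} = {i', 4}"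
    using a by (auto simp: lt5 i'_def w split: if_splits)
  then have *: "c i' * sin (2 * a * x + b) + K\<^sup>2 / 4 * sin (2 * a * x + 2 * b) = 0" if "x \<in> S" for x
    using sep[OF that, of 4] a by (auto simp: i'_def w d c split: if_splits)
  have ci: "c i' = - K / 4"
    using a by (auto simp: i'_def c)
  have s2: "sin (2 * b) = 0" "cos (2 * b) = 1" 
    using sb by (simp_all add: sin_double cos_double_sin)
  have "K / 4 * (K - cos b) * sin (2 * a * x + 0) = 0" if "x \<in> S" for x
  proof -
    have "- K / 4 * (sin (2 * a * x) * cos b) + K\<^sup>2 / 4 * sin (2 * a * x) = 0"
      using *[OF that] by (simp add: ci sin_add sb s2)
    then show ?thesis by (simp add: algebra_simps power2_eq_square)
  qed
  then have "K / 4 * (K - cos b) = 0"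
    using sinusoid_eq_0[OF assms(1,2), of "2 * a"] \<open>a \<noteq> 0\<close> by (metis mult_eq_0_iff zero_neq_numeral)
  then have "K = cos b" using K0 by simp
  moreover have "cos b = 1 \<or> cos b = -1"
    using sb sin_cos_squared_add[of b] by (simp add: power2_eq_1_iff)
  ultimately show "K = 1" "cos b = 1" using \<open>K \<ge> 0\<close> by auto
qed

section \<open>The domain of a rotationally symmetric map\<close>

text \<open>
  The radii of the points of the domain of the map, which is the product of this interval with the
  whole range of angles.
\<close>

definition radial_interval :: "real \<Rightarrow> real \<Rightarrow> real set" where
  "radial_interval a a1 = {r. 0 < r \<and> r < pi \<and> 0 < a * r + a1 \<and> a * r + a1 < pi}"

lemma rot_domain_eq: "rot_domain a a1 k = {x. x $ 1 \<in> radial_interval a a1}"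
  by (auto simp: rot_domain_def radial_interval_def polar_chart_def rot_map_def)

lemma open_radial_interval: "open (radial_interval a a1)"
  unfolding radial_interval_def
  by (intro open_Collect_conj open_Collect_less continuous_intros)

lemma open_rot_domain: "open (rot_domain a a1 k)"
proof -
  have "rot_domain a a1 k = (\<lambda>x. x $ 1) -` radial_interval a a1"
    by (auto simp: rot_domain_eq)
  then show ?thesis
    by (simp add: open_vimage open_radial_interval continuous_intros)
qed

lemma sin_rot_domain:
  assumes "x \<in> rot_domain a a1 k"
  shows "sin (x $ 1) \<noteq> 0" "sin (a * x $ 1 + a1) \<noteq> 0" "sin (rot_map a a1 k x $ 1) \<noteq> 0"
  using assms sin_gt_zero by (fastforce simp: rot_domain_eq radial_interval_def rot_map_def)+

section \<open>Tension and bitension fields of rotationally symmetric maps\<close>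

lemma rot_map_has_derivative:
  "(rot_map a a1 k has_derivative (\<lambda>h. vector [a * h $ 1, k * h $ 2])) (at x)"
proof -
  have e: "(vector [p, q] :: real^2) = p *\<^sub>R axis 1 1 + q *\<^sub>R axis 2 1" for p q
    by (auto simp: vec_eq_iff forall_2 axis_def)
  show ?thesis
    unfolding rot_map_def e
    by (auto intro!: derivative_eq_intros bounded_linear_imp_has_derivative bounded_linear_vec_nth)
qed

lemma push_field_rot_map:
  "push_field (rot_map a a1 k) X x = vector [a * X x $ 1, k * X x $ 2]"
  unfolding push_field_def
  by (simp add: frechet_derivative_at[OF rot_map_has_derivative, symmetric])

lemma Ck_on_const: "Ck_on m (\<lambda>_::real^'n::finite. c) U"
proof (induction m arbitrary: c)
  case (Suc m)
  have "partial_deriv i (\<lambda>_::real^'n. c) = (\<lambda>_. 0)" for i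
    by (simp add: partial_deriv_def fun_eq_iff frechet_derivative_const)
  then show ?case using Suc by simp
qed simp

lemma smooth_on_rot_map: "smooth_on (rot_map a a1 k) U"
  unfolding smooth_on_def
proof
  fix m
  have diff: "rot_map a a1 k differentiable (at x)" for x
    using rot_map_has_derivative differentiableI by blast
  have "partial_deriv i (rot_map a a1 k) = (\<lambda>_. vector [a * axis i 1 $ 1, k * axis i 1 $ 2])" for i
    by (simp add: partial_deriv_def fun_eq_iff frechet_derivative_at[OF rot_map_has_derivative, symmetric])
  then show "Ck_on m (rot_map a a1 k) U"
    using diff by (cases m) (auto simp: Ck_on_const intro!: continuous_at_imp_continuous_on
        differentiable_imp_continuous_within)
qed

lemma levi_civita_coord_fields:
  "levi_civita g (coord_field i) (coord_field j) x = christoffel_form g x (axis i 1) (axis j 1)"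
  using levi_civita_const[of g "axis i 1" "axis j 1" x] by (simp add: coord_field_def[abs_def])

text \<open>
  The covariant derivative along the map of a section whose components depend on \<open>r\<close> only. It
  yields sections of the same kind for constant \<open>X\<close>, so it can be iterated.
\<close>

lemma pullback_connection_rot_map:
  assumes x: "x \<in> rot_domain a a1 k"
    and V: "\<And>z. z \<in> rot_domain a a1 k \<Longrightarrow> V z = vector [P (z $ 1), Q (z $ 1)]"
    and P: "(P has_real_derivative P') (at (x $ 1))"
    and Q: "(Q has_real_derivative Q') (at (x $ 1))"
  shows "pullback_connection sphere_metric (rot_map a a1 k) X V x
    = (let \<rho> = a * x $ 1 + a1 in
       vector [X x $ 1 * P' - k * X x $ 2 * Q (x $ 1) * sin \<rho> * cos \<rho>,
         X x $ 1 * Q' + cot \<rho> * (a * X x $ 1 * Q (x $ 1) + k * X x $ 2 * P (x $ 1))])"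
proof -
  have "frechet_derivative V (at x) = (\<lambda>h. h $ 1 *\<^sub>R vector [P', Q'])"
    by (rule frechet_derivative_first_coord[OF open_rot_domain x V
          has_vector_derivative_vector_2[OF P Q]])
  then show ?thesis
    using sin_rot_domain[OF x]
    by (simp add: pullback_connection_def christoffel_form_sphere push_field_rot_map V[OF x]
        vec_eq_iff forall_2 Let_def)
      (simp add: rot_map_def algebra_simps)
qed

text \<open>
  The coefficient \<open>F\<close> of \<open>\<partial>\<^sub>\<rho>\<close> in the tension field.
\<close>

definition rot_tension :: "real \<Rightarrow> real \<Rightarrow> real \<Rightarrow> real \<Rightarrow> real" where
  "rot_tension a a1 k r
     = a * cot r - k\<^sup>2 * sin (a * r + a1) * cos (a * r + a1) / (sin r)\<^sup>2"

text \<open>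
  Of \<open>\<nabla>d\<phi>\<close> only the value at \<open>(\<partial>\<^sub>\<theta>, \<partial>\<^sub>\<theta>)\<close> contributes: there
  \<open>\<nabla>\<^sub>\<theta> \<partial>\<^sub>\<theta> = - sin r cos r \<partial>\<^sub>r\<close> produces the term \<open>a cot r\<close>, and the same identity on the
  target produces the other one.
\<close>

lemma tension_field_rot_map:
  assumes x: "x \<in> rot_domain a a1 k"
  shows "tension_field sphere_metric sphere_metric (rot_map a a1 k) x
    = vector [rot_tension a a1 k (x $ 1), 0]"
proof -
  have pb: "pullback_connection sphere_metric (rot_map a a1 k) X (push_field (rot_map a a1 k) (coord_field j)) x
    = (let \<rho> = a * x $ 1 + a1; u = axis j 1 :: real^2 in
       vector [- k * X x $ 2 * k * u $ 2 * sin \<rho> * cos \<rho>,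
               cot \<rho> * (a * X x $ 1 * k * u $ 2 + k * X x $ 2 * a * u $ 1)])" for X j
    by (subst pullback_connection_rot_map[OF x, of _ "\<lambda>_. a * axis j 1 $ 1" "\<lambda>_. k * axis j 1 $ 2" 0 0])
       (auto simp: push_field_rot_map coord_field_def Let_def mult.assoc)
  show ?thesis
    using sin_rot_domain[OF x]
    by (simp add: tension_field_def metric_trace_sphere second_fundamental_form_def pb
        push_field_rot_map levi_civita_coord_fields christoffel_form_sphere)
      (simp add: vec_eq_iff forall_2 Let_def coord_field_def axis_def rot_tension_def cot_def
        field_simps power2_eq_square)
qed

text \<open>
  The derivatives of \<open>F\<close> are parameters, so that the formula serves both for the explicit
  derivatives and for \<open>F = 0\<close> on the interval. The factor \<open>cos (2 \<rho>) = cos\<^sup>2 \<rho> - sin\<^sup>2 \<rho>\<close> combines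
  the second derivative in the direction \<open>\<theta>\<close> with the curvature term.
\<close>

lemma bitension_field_rot_map:
  assumes x: "x \<in> rot_domain a a1 k"
    and F': "\<And>z. z \<in> rot_domain a a1 k \<Longrightarrow>
      (rot_tension a a1 k has_real_derivative F' (z $ 1)) (at (z $ 1))"
    and F'': "(F' has_real_derivative F'') (at (x $ 1))"
  shows "bitension_field sphere_metric sphere_metric (rot_map a a1 k) x
    = vector [F'' + cot (x $ 1) * F' (x $ 1)
       - k\<^sup>2 * cos (2 * (a * x $ 1 + a1)) / (sin (x $ 1))\<^sup>2 * rot_tension a a1 k (x $ 1), 0]"
proof -
  let ?U = "rot_domain a a1 k" and ?\<phi> = "rot_map a a1 k" and ?F = "rot_tension a a1 k"
  let ?\<tau> = "tension_field sphere_metric sphere_metric ?\<phi>"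
  let ?D = "pullback_connection sphere_metric ?\<phi>"
  let ?\<rho> = "\<lambda>z::real^2. a * z $ 1 + a1"
  note s = sin_rot_domain[OF x]
  have D: "?D X ?\<tau> z = vector [X z $ 1 * F' (z $ 1), cot (?\<rho> z) * (k * X z $ 2 * ?F (z $ 1))]"
    if "z \<in> ?U" for X z
    by (subst pullback_connection_rot_map[OF that, of _ ?F "\<lambda>_. 0" "F' (z $ 1)" 0])
       (auto simp: tension_field_rot_map F'[OF that] Let_def)
  have D11: "?D (coord_field 1) (?D (coord_field 1) ?\<tau>) x = vector [F'', 0]"
    by (subst pullback_connection_rot_map[OF x, of _ F' "\<lambda>_. 0" F'' 0])
       (auto simp: D F'' Let_def coord_field_def axis_def)
  have cot': "((\<lambda>r. cot (a * r + a1)) has_real_derivative - a / (sin (?\<rho> x))\<^sup>2) (at (x $ 1))"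
    by (rule DERIV_chain2[where g = "\<lambda>r. a * r + a1" and Db = a, OF cot_has_derivative[OF s(2)],
          THEN DERIV_cong]) (auto intro!: derivative_eq_intros)
  have D22: "?D (coord_field 2) (?D (coord_field 2) ?\<tau>) x
      = vector [- k\<^sup>2 * (cos (?\<rho> x))\<^sup>2 * ?F (x $ 1), 0]"
  proof -
    have Q: "((\<lambda>r. cot (a * r + a1) * (k * ?F r)) has_real_derivative
        - a / (sin (?\<rho> x))\<^sup>2 * (k * ?F (x $ 1)) + k * F' (x $ 1) * cot (?\<rho> x)) (at (x $ 1))"
      by (intro DERIV_mult cot' DERIV_cmult F'[OF x])
    have "?D (coord_field 2) ?\<tau> z = vector [0, cot (a * z $ 1 + a1) * (k * ?F (z $ 1))]" if "z \<in> ?U" for z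
      by (simp add: D[OF that] coord_field_def axis_def)
    from pullback_connection_rot_map[OF x this DERIV_const Q] show ?thesis
      using s by (simp add: Let_def coord_field_def axis_def cot_def power2_eq_square mult_ac)
  qed
  have R: "curvature_at sphere_metric (?\<phi> x) (push_field ?\<phi> (coord_field i) x) (?\<tau> x)
        (push_field ?\<phi> (coord_field i) x)
      = vector [- k\<^sup>2 * (sin (?\<rho> x))\<^sup>2 * (axis i 1 $ 2) * ?F (x $ 1), 0]" for i
    using s exhaust_2[of i]
    by (auto simp: sphere_curvature tension_field_rot_map[OF x] push_field_rot_map coord_field_def axis_def
        vec_eq_iff forall_2)
      (auto simp: rot_map_def power2_eq_square)
  have L: "levi_civita sphere_metric (coord_field i) (coord_field i) x
      = vector [- sin (x $ 1) * cos (x $ 1) * axis i 1 $ 2, 0]" for i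
    using s exhaust_2[of i] by (auto simp: levi_civita_coord_fields christoffel_form_sphere axis_def)
  show ?thesis
    unfolding bitension_field_def cos_double
    using s
    by (simp add: metric_trace_sphere D11 D22 R D[OF x] L axis_def vec_eq_iff forall_2 cot_def)
       (simp add: field_simps power2_eq_square)
qed

section \<open>Biharmonicity as a trigonometric identity\<close>

definition rot_tension' :: "real \<Rightarrow> real \<Rightarrow> real \<Rightarrow> real \<Rightarrow> real" where
  "rot_tension' a a1 k r
     = - a * (1 + k\<^sup>2 * cos (2 * (a * r + a1))) / (sin r)\<^sup>2
       + k\<^sup>2 * sin (2 * (a * r + a1)) * cos r / (sin r) ^ 3"

lemma rot_tension_has_derivative:
  assumes "sin r \<noteq> 0"
  shows "(rot_tension a a1 k has_real_derivative rot_tension' a a1 k r) (at r)"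
proof -
  have e: "rot_tension a a1 k = (\<lambda>r. a * cot r - k\<^sup>2 / 2 * sin (2 * (a * r + a1)) / (sin r)\<^sup>2)"
    unfolding rot_tension_def sin_double by (simp add: fun_eq_iff)
  show ?thesis
    unfolding e rot_tension'_def
    using assms
    by (auto intro!: derivative_eq_intros cot_has_derivative)
       (simp add: field_simps power2_eq_square power3_eq_cube power4_eq_xxxx)
qed

definition rot_tension'' :: "real \<Rightarrow> real \<Rightarrow> real \<Rightarrow> real \<Rightarrow> real" where
  "rot_tension'' a a1 k r = (let u = 2 * (a * r + a1) in
      (2 * k\<^sup>2 * a\<^sup>2 - k\<^sup>2) * sin u / (sin r)\<^sup>2
      + (2 * a + 4 * k\<^sup>2 * a * cos u) * cos r / (sin r) ^ 3
      - 3 * k\<^sup>2 * sin u * (cos r)\<^sup>2 / (sin r) ^ 4)"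

lemma rot_tension'_has_derivative:
  assumes "sin r \<noteq> 0"
  shows "(rot_tension' a a1 k has_real_derivative rot_tension'' a a1 k r) (at r)"
proof -
  \<comment> \<open>As a polynomial in \<open>1 / sin r\<close> the function is differentiated without quotients.\<close>
  define u i where "u = (\<lambda>r. 2 * (a * r + a1))" and "i = (\<lambda>r::real. inverse (sin r))"
  have e: "rot_tension' a a1 k
      = (\<lambda>r. - a * (1 + k\<^sup>2 * cos (u r)) * (i r)\<^sup>2 + k\<^sup>2 * sin (u r) * cos r * (i r) ^ 3)"
    by (simp add: fun_eq_iff rot_tension'_def u_def i_def divide_inverse power_inverse)
  have u': "(u has_real_derivative 2 * a) (at r)"
    unfolding u_def by (auto intro!: derivative_eq_intros)
  have i': "(i has_real_derivative - cos r * (i r)\<^sup>2) (at r)"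
    unfolding i_def using assms
    by (auto intro!: derivative_eq_intros simp: power2_eq_square)
  have si: "sin r * i r = 1"
    using assms by (simp add: i_def)
  then have si3: "sin r * (i r) ^ 3 = (i r)\<^sup>2"
    by (simp add: power3_eq_cube power2_eq_square)
  have "(rot_tension' a a1 k has_real_derivative
      (2 * a\<^sup>2 * k\<^sup>2 * sin (u r)) * (i r)\<^sup>2 + 2 * a * (1 + k\<^sup>2 * cos (u r)) * cos r * (i r) ^ 3
      + 2 * a * k\<^sup>2 * cos (u r) * cos r * (i r) ^ 3 - k\<^sup>2 * sin (u r) * (sin r * (i r) ^ 3)
      - 3 * k\<^sup>2 * sin (u r) * (cos r)\<^sup>2 * (i r) ^ 4) (at r)"
    unfolding e
    by (auto intro!: derivative_eq_intros u' i')
       (simp add: algebra_simps power2_eq_square power3_eq_cube power4_eq_xxxx)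
  then show ?thesis
    by (rule DERIV_cong)
       (simp add: si3 rot_tension''_def Let_def flip: u_def,
        simp add: i_def u_def divide_inverse power_inverse algebra_simps)
qed

text \<open>
  With \<open>u = 2 \<rho>\<close>, clearing denominators leaves products of \<open>sin u\<close>, \<open>cos u\<close>, \<open>sin r\<close>, \<open>cos r\<close>
  without poles; the angle sum formulas turn these into sinusoids in \<open>t = 2 r\<close>.
\<close>

lemma bitension_trig_polynomial:
  assumes "sin r \<noteq> 0"
  shows "(sin r) ^ 4 * (rot_tension'' a a1 k r + cot r * rot_tension' a a1 k r
       - k\<^sup>2 * cos (2 * (a * r + a1)) / (sin r)\<^sup>2 * rot_tension a a1 k r)
    = a / 2 * sin (2 * r) + k\<^sup>2 * (a\<^sup>2 - 3/2) * sin (a * (2 * r) + 2 * a1)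
       - k\<^sup>2 / 2 * (a\<^sup>2 - a + 1/2) * sin ((a + 1) * (2 * r) + 2 * a1)
       - k\<^sup>2 / 2 * (a\<^sup>2 + a + 1/2) * sin ((a - 1) * (2 * r) + 2 * a1)
       + (k\<^sup>2)\<^sup>2 / 4 * sin (2 * a * (2 * r) + 2 * (2 * a1))" (is "?L = ?R")
proof -
  define s c su cu where "s = sin r" and "c = cos r"
    and "su = sin (2 * (a * r + a1))" and "cu = cos (2 * (a * r + a1))"
  have s0: "s \<noteq> 0" using assms by (simp add: s_def)
  have c2: "c\<^sup>2 = 1 - s\<^sup>2" by (simp add: s_def c_def cos_squared_eq)
  have t: "rot_tension a a1 k r = a * c / s - k\<^sup>2 * su / (2 * s\<^sup>2)"
    unfolding rot_tension_def s_def c_def su_def cot_def sin_double by simp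
  have "?L = s ^ 4 * ((2 * k\<^sup>2 * a\<^sup>2 - k\<^sup>2) * su / s\<^sup>2 + (2 * a + 4 * k\<^sup>2 * a * cu) * c / s ^ 3
      - 3 * k\<^sup>2 * su * c\<^sup>2 / s ^ 4 + c / s * (- a * (1 + k\<^sup>2 * cu) / s\<^sup>2 + k\<^sup>2 * su * c / s ^ 3)
      - k\<^sup>2 * cu / s\<^sup>2 * (a * c / s - k\<^sup>2 * su / (2 * s\<^sup>2)))"
    unfolding t rot_tension'_def rot_tension''_def Let_def cot_def
    by (simp only: s_def c_def su_def cu_def)
  also have "\<dots> = a * c * s + (2 * k\<^sup>2 * a\<^sup>2 - k\<^sup>2) * su * s\<^sup>2 + 2 * k\<^sup>2 * a * cu * c * s
      - 2 * k\<^sup>2 * su * c\<^sup>2 + k\<^sup>2 * k\<^sup>2 / 2 * su * cu"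
    using s0 by (simp add: field_simps power2_eq_square power3_eq_cube power4_eq_xxxx)
  also have "\<dots> = a / 2 * (2 * s * c) + k\<^sup>2 * (a\<^sup>2 - 3/2) * su
       - k\<^sup>2 / 2 * (a\<^sup>2 - a + 1/2) * (su * (1 - 2 * s\<^sup>2) + cu * (2 * s * c))
       - k\<^sup>2 / 2 * (a\<^sup>2 + a + 1/2) * (su * (1 - 2 * s\<^sup>2) - cu * (2 * s * c))
       + (k\<^sup>2)\<^sup>2 / 4 * (2 * su * cu)"
    unfolding c2 by (simp add: field_simps power2_eq_square)
  also have "\<dots> = ?R"
  proof -
    have args: "a * (2 * r) + 2 * a1 = 2 * (a * r + a1)"
      "(a + 1) * (2 * r) + 2 * a1 = 2 * (a * r + a1) + 2 * r"
      "(a - 1) * (2 * r) + 2 * a1 = 2 * (a * r + a1) - 2 * r"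
      "2 * a * (2 * r) + 2 * (2 * a1) = 2 * (2 * (a * r + a1))"
      by (simp_all add: algebra_simps)
    have dbl: "sin (2 * r) = 2 * s * c" "cos (2 * r) = 1 - 2 * s\<^sup>2"
      by (simp_all add: sin_double cos_double_sin s_def c_def)
    show ?thesis
      unfolding args sin_add sin_diff dbl sin_double[of "2 * (a * r + a1)"]
      by (simp only: su_def cu_def)
  qed
  finally show ?thesis .
qed

lemma bitension_rot_map_eq_0_iff:
  assumes x: "x \<in> rot_domain a a1 k"
  shows "bitension_field sphere_metric sphere_metric (rot_map a a1 k) x = 0
    \<longleftrightarrow> a / 2 * sin (2 * x $ 1) + k\<^sup>2 * (a\<^sup>2 - 3/2) * sin (a * (2 * x $ 1) + 2 * a1)
       - k\<^sup>2 / 2 * (a\<^sup>2 - a + 1/2) * sin ((a + 1) * (2 * x $ 1) + 2 * a1)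
       - k\<^sup>2 / 2 * (a\<^sup>2 + a + 1/2) * sin ((a - 1) * (2 * x $ 1) + 2 * a1)
       + (k\<^sup>2)\<^sup>2 / 4 * sin (2 * a * (2 * x $ 1) + 2 * (2 * a1)) = 0"
proof -
  note s = sin_rot_domain(1)[OF x]
  let ?E = "rot_tension'' a a1 k (x $ 1) + cot (x $ 1) * rot_tension' a a1 k (x $ 1)
       - k\<^sup>2 * cos (2 * (a * x $ 1 + a1)) / (sin (x $ 1))\<^sup>2 * rot_tension a a1 k (x $ 1)"
  have "bitension_field sphere_metric sphere_metric (rot_map a a1 k) x = vector [?E, 0]"
    by (intro bitension_field_rot_map x rot_tension_has_derivative rot_tension'_has_derivative s)
       (rule sin_rot_domain(1))
  then have "bitension_field sphere_metric sphere_metric (rot_map a a1 k) x = 0 \<longleftrightarrow> ?E = 0"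
    by (simp add: vec_eq_iff forall_2)
  also have "\<dots> \<longleftrightarrow> (sin (x $ 1)) ^ 4 * ?E = 0"
    using s by simp
  finally show ?thesis
    unfolding bitension_trig_polynomial[OF s] .
qed

section \<open>Classification of the biharmonic maps\<close>

text \<open>
  If \<open>F\<close> vanishes on the radial interval, so do its derivatives.
\<close>

lemma rot_map_harmonic_imp_biharmonic:
  assumes "harmonic_on sphere_metric sphere_metric (rot_map a a1 k) (rot_domain a a1 k)"
  shows "biharmonic_on sphere_metric sphere_metric (rot_map a a1 k) (rot_domain a a1 k)"
proof -
  have 0: "rot_tension a a1 k r = 0" if "r \<in> radial_interval a a1" for r
  proof -
    have "vector [r, 0] \<in> rot_domain a a1 k"
      using that by (simp add: rot_domain_eq)
    then show ?thesis
      using assms tension_field_rot_map[of "vector [r, 0]" a a1 k]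
      by (simp add: harmonic_on_def vec_eq_iff forall_2)
  qed
  have "(rot_tension a a1 k has_real_derivative 0) (at r)" if "r \<in> radial_interval a a1" for r
    by (rule has_field_derivative_transform_within_open[OF DERIV_const[of 0] open_radial_interval that])
       (simp add: 0)
  then have "bitension_field sphere_metric sphere_metric (rot_map a a1 k) x = vector [0, 0]"
    if "x \<in> rot_domain a a1 k" for x
    using that bitension_field_rot_map[OF that, of "\<lambda>_. 0" 0] 0 by (simp add: rot_domain_eq)
  then show ?thesis
    using smooth_on_rot_map by (simp add: biharmonic_on_def vec_eq_iff forall_2)
qed

lemma rot_map_biharmonic_parameters:
  assumes "a \<noteq> 0" and ne: "radial_interval a a1 \<noteq> {}"
    and bih: "biharmonic_on sphere_metric sphere_metric (rot_map a a1 k) (rot_domain a a1 k)"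
  shows "a\<^sup>2 = 1 \<and> k\<^sup>2 = 1 \<and> (a1 = 0 \<or> a1 = pi)"
proof -
  obtain r0 where r0: "r0 \<in> radial_interval a a1" using ne by blast
  \<comment> \<open>The values of \<open>t = 2 r\<close>.\<close>
  define S where "S = (\<lambda>t. t / 2) -` radial_interval a a1"
  have "open S"
    unfolding S_def by (intro open_vimage open_radial_interval continuous_intros) simp
  moreover have "S \<noteq> {}"
  proof -
    have "2 * r0 \<in> S" using r0 by (simp add: S_def)
    then show ?thesis by blast
  qed
  moreover have "a / 2 * sin t + k\<^sup>2 * (a\<^sup>2 - 3/2) * sin (a * t + 2 * a1)
     - k\<^sup>2 / 2 * (a\<^sup>2 - a + 1/2) * sin ((a + 1) * t + 2 * a1)
     - k\<^sup>2 / 2 * (a\<^sup>2 + a + 1/2) * sin ((a - 1) * t + 2 * a1)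
     + (k\<^sup>2)\<^sup>2 / 4 * sin (2 * a * t + 2 * (2 * a1)) = 0" if "t \<in> S" for t
  proof -
    have t: "vector [t / 2, 0] \<in> rot_domain a a1 k"
      using that by (simp add: rot_domain_eq S_def)
    with bih have "bitension_field sphere_metric sphere_metric (rot_map a a1 k) (vector [t / 2, 0]) = 0"
      by (simp add: biharmonic_on_def)
    then show ?thesis
      unfolding bitension_rot_map_eq_0_iff[OF t] by simp
  qed
  ultimately have *: "a\<^sup>2 = 1" "k\<^sup>2 = 1" "cos (2 * a1) = 1"
    using trig_identity_solutions[of S a "k\<^sup>2" "2 * a1"] \<open>a \<noteq> 0\<close> by auto
  have "sin a1 = 0" using *(3) by (simp add: cos_double_sin)
  \<comment> \<open>At \<open>r0\<close> both \<open>r\<close> and \<open>a r + a\<^sub>1\<close> lie in \<open>(0, \<pi>)\<close>, with \<open>a = \<plusminus>1\<close>.\<close>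
  moreover have "- pi < a1" "a1 < 2 * pi"
    using r0 *(1) by (auto simp: radial_interval_def power2_eq_1_iff)
  ultimately have "a1 = 0 \<or> a1 = pi"
    using sin_gt_zero[of a1] sin_gt_zero[of "- a1"] sin_lt_zero[of a1] by fastforce
  with * show ?thesis by blast
qed

lemma rot_map_harmonic:
  assumes "a\<^sup>2 = 1" "k\<^sup>2 = 1" "a1 = 0 \<or> a1 = pi"
  shows "harmonic_on sphere_metric sphere_metric (rot_map a a1 k) (rot_domain a a1 k)"
proof -
  have "rot_tension a a1 k r = 0" if "r \<in> radial_interval a a1" for r
  proof -
    have "sin r > 0" using that by (auto simp: radial_interval_def sin_gt_zero)
    \<comment> \<open>For \<open>\<rho> = r + \<pi>\<close> and for \<open>\<rho> = - r\<close> the interval would be empty.\<close>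
    moreover have "a = 1 \<and> a1 = 0 \<or> a = -1 \<and> a1 = pi"
      using assms that by (auto simp: radial_interval_def power2_eq_1_iff)
    ultimately show ?thesis
      using \<open>k\<^sup>2 = 1\<close> by (auto simp: rot_tension_def cot_def power2_eq_square)
  qed
  then have "tension_field sphere_metric sphere_metric (rot_map a a1 k) x = vector [0, 0]"
    if "x \<in> rot_domain a a1 k" for x
    using that by (simp add: tension_field_rot_map rot_domain_eq)
  then show ?thesis
    using smooth_on_rot_map by (simp add: harmonic_on_def vec_eq_iff forall_2)
qed

theorem theorem3p1:
  fixes a a1 k :: real
  assumes "a \<noteq> 0"
    and "rot_domain a a1 k \<noteq> {}"
  shows "(biharmonic_on sphere_metric sphere_metric (rot_map a a1 k) (rot_domain a a1 k)
            \<longleftrightarrow> a\<^sup>2 = 1 \<and> k\<^sup>2 = 1 \<and> (a1 = 0 \<or> a1 = pi))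
         \<and> (biharmonic_on sphere_metric sphere_metric (rot_map a a1 k) (rot_domain a a1 k)
            \<longrightarrow> harmonic_on sphere_metric sphere_metric (rot_map a a1 k) (rot_domain a a1 k))"
  using assms rot_map_biharmonic_parameters[of a a1 k] rot_map_harmonic[of a k a1]
    rot_map_harmonic_imp_biharmonic[of a a1 k]
  by (auto simp: rot_domain_eq)

end
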